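(* Let $F,f:\mathbb{R}^n\times\mathbb{R}^m\to\mathbb{R}$, $G=(G_1,\dots,G_p):\mathbb{R}^n\times\mathbb{R}^m\to\mathbb{R}^p$, $g=(g_1,\dots,g_q):\mathbb{R}^n\times\mathbb{R}^m\to\mathbb{R}^q$. Let $(\bar x,\bar y)$ be a local minimizer of the bilevel problem $$\min_{x,y}F(x,y)\quad\text{s.t.}\quad y\in S(x),\ G(x,y)\le 0,$$ where $S(x)$ is the solution set of the lower-level problem $\min_y f(x,y)$ s.t. $g(x,y)\le 0$. Let $V(x):=\inf_y\{f(x,y):g(x,y)\le 0\}$, $H(x,y):=f(x,y)-V(x)$, and let $\Xi$ be the set of $(x,y)$ with $H(x,y)\le 0$, $g_i(x,y)\le 0$ ($i=1,\dots,q$) and $G_j(x,y)\le 0$ ($j=1,\dots,p$). Assume that the contingent tangent cone $T_\Xi(\bar x,\bar y)$ is convex, that $F,H,g_i,G_j$ are locally Lipschitz and tangentially convex in a neighbourhood of $(\bar x,\bar y)$, and that $V$ is locally Lipschitz and tangentially convex around $\bar x$. Then the value-function reformulation $$\min_{x,y}F(x,y)\quad\text{s.t.}\quad H(x,y)\le 0,\ g_i(x,y)\le 0\ (i=1,\dots,q),\ G_j(x,y)\le 0\ (j=1,\dots,p)$$ satisfies the sequential enhanced T-Fritz--John type condition at $(\bar x,\bar y)$: with $\mathcal{X}=\mathbb{R}^n\times\mathbb{R}^m$, there exist points $z^k\in\mathcal{X}$, $z^k\to(\bar x,\bar y)$, multipliers $\mu_0^k,\lambda^k,\alpha_1^k,\dots,\alpha_q^k,\beta_1^k,\dots,\beta_p^k\ge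 0$, and vectors $\xi_F^k\in\partial_TF(z^k)$, $\xi_H^k\in\partial_TH(z^k)$, $\xi_i^k\in\partial_Tg_i(z^k)$, $\zeta_j^k\in\partial_TG_j(z^k)$, $\eta_k\in N_{\mathcal{X}}(z^k)=\{0\}$ such that $$\Big\|\mu_0^k\xi_F^k+\lambda^k\xi_H^k+\sum_{i=1}^q\alpha_i^k\xi_i^k+\sum_{j=1}^p\beta_j^k\zeta_j^k+\eta_k\Big\|\to 0,$$ $$\min\{\lambda^k,-H(z^k)\}\to 0,\quad \min\{\alpha_i^k,-g_i(z^k)\}\to 0\ (i=1,\dots,q),\quad \min\{\beta_j^k,-G_j(z^k)\}\to 0\ (j=1,\dots,p),$$ $$(\mu_0^k)^2+(\lambda^k)^2+\sum_{i=1}^q(\alpha_i^k)^2+\sum_{j=1}^p(\beta_j^k)^2=1\quad\text{for all }k.$$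
   Context: For a function $h$ on a Euclidean space with values in $\mathbb{R}\cup\{+\infty\}$ and $\bar z\in\operatorname{dom}h$, the directional derivative is $h'(\bar z;v):=\lim_{t\downarrow 0}\frac{h(\bar z+tv)-h(\bar z)}{t}$ whenever the limit exists. $h$ is tangentially convex at $\bar z$ if $h'(\bar z;v)$ exists and is finite for every direction $v$ and $v\mapsto h'(\bar z;v)$ is convex; "around $\bar z$" means at every point of a neighbourhood of $\bar z$. The tangential subdifferential is $\partial_T h(\bar z):=\{\xi:\langle\xi,v\rangle\le h'(\bar z;v)\ \forall v\}$. Local Lipschitz continuity around a point includes finiteness near that point. For nonempty $S$ and $\bar z\in S$, the contingent tangent cone is $T_S(\bar z):=\{d:\exists t_k\downarrow 0,\ d_k\to d\text{ with }\bar z+t_kd_k\in S\}$; $N_S$ denotes the limiting normal cone. Vector inequalities are componentwise. A local minimizer of the bilevel problem is a feasible $(\bar x,\bar y)$ (i.e. $\bar y\in S(\bar x)$, $G(\bar x,\bar y)\le 0$) with $F(\bar x,\bar y)\le F(x,y)$ for all feasible $(x,y)$ in some neighbourhood. *)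

theory Defs
  imports "HOL-Analysis.Analysis"
begin

text \<open>
  Functions with values in the extended reals are of type \<open>'a \<Rightarrow> ereal\<close>; a real-valued function
  \<open>h\<close> is regarded as \<open>\<lambda>z. ereal (h z)\<close>.
\<close>

definition diff_quot :: "('a::euclidean_space \<Rightarrow> ereal) \<Rightarrow> 'a \<Rightarrow> 'a \<Rightarrow> real \<Rightarrow> ereal" where
  "diff_quot h z v t = (h (z + t *\<^sub>R v) - h z) / ereal t"

definition dir_deriv_exists :: "('a::euclidean_space \<Rightarrow> ereal) \<Rightarrow> 'a \<Rightarrow> 'a \<Rightarrow> bool" where
  "dir_deriv_exists h z v \<longleftrightarrow> (\<exists>L. (diff_quot h z v \<longlongrightarrow> L) (at_right 0))"

text \<open>Only meaningful together with \<open>dir_deriv_exists\<close> and finiteness of \<open>h z\<close>.\<close>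

definition dir_deriv :: "('a::euclidean_space \<Rightarrow> ereal) \<Rightarrow> 'a \<Rightarrow> 'a \<Rightarrow> ereal" where
  "dir_deriv h z v = Lim (at_right 0) (diff_quot h z v)"

definition tangentially_convex_at :: "('a::euclidean_space \<Rightarrow> ereal) \<Rightarrow> 'a \<Rightarrow> bool" where
  "tangentially_convex_at h z \<longleftrightarrow>
     \<bar>h z\<bar> \<noteq> \<infinity> \<and>
     (\<forall>v. dir_deriv_exists h z v \<and> \<bar>dir_deriv h z v\<bar> \<noteq> \<infinity>) \<and>
     convex_on UNIV (\<lambda>v. real_of_ereal (dir_deriv h z v))"

definition tangentially_convex_around :: "('a::euclidean_space \<Rightarrow> ereal) \<Rightarrow> 'a \<Rightarrow> bool" where
  "tangentially_convex_around h z \<longleftrightarrow> (\<forall>\<^sub>F u in nhds z. tangentially_convex_at h u)"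

definition tangential_subdiff :: "('a::euclidean_space \<Rightarrow> ereal) \<Rightarrow> 'a \<Rightarrow> 'a set" where
  "tangential_subdiff h z =
     {\<xi>. \<bar>h z\<bar> \<noteq> \<infinity> \<and> (\<forall>v. dir_deriv_exists h z v \<and> ereal (\<xi> \<bullet> v) \<le> dir_deriv h z v)}"

definition locally_lipschitz_around :: "('a::euclidean_space \<Rightarrow> ereal) \<Rightarrow> 'a \<Rightarrow> bool" where
  "locally_lipschitz_around h z \<longleftrightarrow>
     (\<exists>\<epsilon>>0. \<exists>L. (\<forall>u\<in>ball z \<epsilon>. \<bar>h u\<bar> \<noteq> \<infinity>) \<and>
        L-lipschitz_on (ball z \<epsilon>) (\<lambda>u. real_of_ereal (h u)))"

definition contingent_cone :: "'a::euclidean_space set \<Rightarrow> 'a \<Rightarrow> 'a set" where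
  "contingent_cone S z =
     {d. \<exists>(t :: nat \<Rightarrow> real) (e :: nat \<Rightarrow> 'a).
           (\<forall>k. t k > 0) \<and> t \<longlonglongrightarrow> 0 \<and> e \<longlonglongrightarrow> d \<and> (\<forall>k. z + t k *\<^sub>R e k \<in> S)}"

definition frechet_normal_cone :: "'a::euclidean_space set \<Rightarrow> 'a \<Rightarrow> 'a set" where
  "frechet_normal_cone S z =
     {\<xi>. \<forall>\<epsilon>>0. \<forall>\<^sub>F u in at z within S. \<xi> \<bullet> (u - z) \<le> \<epsilon> * norm (u - z)}"

text \<open>The Mordukhovich normal cone: the sequential outer limit of the Frechet normal cones.\<close>

definition limiting_normal_cone :: "'a::euclidean_space set \<Rightarrow> 'a \<Rightarrow> 'a set" where
  "limiting_normal_cone S z =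
     {\<xi>. \<exists>(u :: nat \<Rightarrow> 'a) (\<nu> :: nat \<Rightarrow> 'a).
           (\<forall>k. u k \<in> S) \<and> u \<longlonglongrightarrow> z \<and> \<nu> \<longlonglongrightarrow> \<xi> \<and> (\<forall>k. \<nu> k \<in> frechet_normal_cone S (u k))}"

definition local_minimizer_on :: "('a::topological_space \<Rightarrow> real) \<Rightarrow> 'a set \<Rightarrow> 'a \<Rightarrow> bool" where
  "local_minimizer_on F S z \<longleftrightarrow>
     z \<in> S \<and> (\<exists>U. open U \<and> z \<in> U \<and> (\<forall>w\<in>S \<inter> U. F z \<le> F w))"

text \<open>
  A map into \<open>\<real>\<^sup>q\<close> is represented by its components \<open>g 1, \<dots>, g q\<close>; the values of \<open>g\<close> at
  other indices are never used, and \<open>q = 0\<close> (no constraints) is allowed.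
\<close>

definition lower_feasible ::
  "nat \<Rightarrow> (nat \<Rightarrow> 'x \<times> 'y \<Rightarrow> real) \<Rightarrow> 'x \<Rightarrow> 'y set" where
  "lower_feasible q g x = {y. \<forall>i\<in>{1..q}. g i (x, y) \<le> 0}"

definition lower_solutions ::
  "nat \<Rightarrow> (nat \<Rightarrow> 'x \<times> 'y \<Rightarrow> real) \<Rightarrow> ('x \<times> 'y \<Rightarrow> real) \<Rightarrow> 'x \<Rightarrow> 'y set" where
  "lower_solutions q g f x =
     {y \<in> lower_feasible q g x. \<forall>y'\<in>lower_feasible q g x. f (x, y) \<le> f (x, y')}"

definition bilevel_feasible ::
  "nat \<Rightarrow> (nat \<Rightarrow> 'x \<times> 'y \<Rightarrow> real) \<Rightarrow> nat \<Rightarrow> (nat \<Rightarrow> 'x \<times> 'y \<Rightarrow> real) \<Rightarrow> ('x \<times> 'y \<Rightarrow> real)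
     \<Rightarrow> ('x \<times> 'y) set" where
  "bilevel_feasible p G q g f =
     {(x, y). y \<in> lower_solutions q g f x \<and> (\<forall>j\<in>{1..p}. G j (x, y) \<le> 0)}"

text \<open>
  The infimum is taken in the extended reals: it is \<open>\<infinity>\<close> for an infeasible and \<open>-\<infinity>\<close> for an
  unbounded lower-level problem.
\<close>

definition value_fun ::
  "nat \<Rightarrow> (nat \<Rightarrow> 'x \<times> 'y \<Rightarrow> real) \<Rightarrow> ('x \<times> 'y \<Rightarrow> real) \<Rightarrow> 'x \<Rightarrow> ereal" where
  "value_fun q g f x = (INF y\<in>lower_feasible q g x. ereal (f (x, y)))"

definition gap_fun ::
  "nat \<Rightarrow> (nat \<Rightarrow> 'x \<times> 'y \<Rightarrow> real) \<Rightarrow> ('x \<times> 'y \<Rightarrow> real) \<Rightarrow> 'x \<times> 'y \<Rightarrow> ereal" where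
  "gap_fun q g f = (\<lambda>(x, y). ereal (f (x, y)) - value_fun q g f x)"

definition value_feasible ::
  "nat \<Rightarrow> (nat \<Rightarrow> 'x \<times> 'y \<Rightarrow> real) \<Rightarrow> nat \<Rightarrow> (nat \<Rightarrow> 'x \<times> 'y \<Rightarrow> real) \<Rightarrow> ('x \<times> 'y \<Rightarrow> real)
     \<Rightarrow> ('x \<times> 'y) set" where
  "value_feasible p G q g f =
     {z. gap_fun q g f z \<le> 0 \<and> (\<forall>i\<in>{1..q}. g i z \<le> 0) \<and> (\<forall>j\<in>{1..p}. G j z \<le> 0)}"

end

theory Submission
  imports Defs
begin

text \<open>
  Minimize \<open>F + c (\<Sum>i. (max 0 (h\<^sub>i))\<^sup>2) / 2 + \<parallel>z - zbar\<parallel>\<^sup>2 / 2\<close> over a small ball, for \<open>c = 1, 2, \<dots>\<close>.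
  Cluster points of the minimizers are feasible, hence equal to \<open>zbar\<close>, so the minimizers are
  eventually interior. There the directional derivative
  \<open>F'(z; v) + (\<Sum>i. c max 0 (h\<^sub>i z) h\<^sub>i'(z; v)) + \<langle>z - zbar, v\<rangle>\<close> is nonnegative, and since all summands
  are convex in \<open>v\<close>, separation splits it into tangential subgradients that sum up to
  \<open>zbar - z\<close>. Normalizing the multipliers gives the condition. The value-function constraint needs
  no special treatment because the feasible sets of the two problems coincide.
\<close>

section \<open>Convex separation\<close>

text \<open>The strict epigraph of \<open>\<phi>\<close> and the hypograph of
  \<open>- \<psi>\<close> are disjoint convex sets. The hyperplane separating them passes through
  the origin and is not vertical, because both functions are finite everywhere; so it is the graph
  of the wanted linear functional.\<close>

lemma convex_sandwich:
  fixes \<phi> \<psi> :: "'a::euclidean_space \<Rightarrow> real"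
  assumes \<phi>: "convex_on UNIV \<phi>" and \<psi>: "convex_on UNIV \<psi>"
    and zero: "\<phi> 0 = 0" "\<psi> 0 = 0"
    and nonneg: "\<And>v. 0 \<le> \<phi> v + \<psi> v"
  obtains \<xi> where "\<And>v. \<xi> \<bullet> v \<le> \<phi> v" "\<And>v. - (\<xi> \<bullet> v) \<le> \<psi> v"
proof -
  \<comment> \<open>Only \<open>A\<close> is strict: the graphs of \<open>\<phi>\<close> and
    \<open>- \<psi>\<close> touch at the origin, so two closed sets would meet.\<close>
  define A where "A = {x :: 'a \<times> real. \<phi> (fst x) < snd x}"
  define B where "B = {x :: 'a \<times> real. \<psi> (fst x) \<le> - snd x}"
  have "convex A"
    unfolding convex_def A_def
  proof (clarsimp simp del: not_less)
    fix v s w t and a b :: real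
    assume h: "\<phi> v < s" "\<phi> w < t" "0 \<le> a" "0 \<le> b" "a + b = 1"
    have "\<phi> (a *\<^sub>R v + b *\<^sub>R w) \<le> a * \<phi> v + b * \<phi> w"
      using \<phi> h unfolding convex_on_def by blast
    also have "\<dots> < a * s + b * t"
    \<comment> \<open>A strict inequality survives only under a positive weight; when
      \<open>a = 0\<close>, the weight \<open>b = 1\<close> supplies it.\<close>
    proof (cases "a = 0")
      case True
      with h show ?thesis by simp
    next
      case False
      with h have "a * \<phi> v < a * s" "b * \<phi> w \<le> b * t"
        by (simp_all add: mult_left_mono)
      then show ?thesis by linarith
    qed
    finally show "\<phi> (a *\<^sub>R v + b *\<^sub>R w) < a * s + b * t" .
  qed
  moreover have "convex B"
    unfolding convex_def B_def
  proof clarsimp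
    fix v s w t and a b :: real
    assume h: "\<psi> v \<le> - s" "\<psi> w \<le> - t" "0 \<le> a" "0 \<le> b" "a + b = 1"
    have "\<psi> (a *\<^sub>R v + b *\<^sub>R w) \<le> a * \<psi> v + b * \<psi> w"
      using \<psi> h unfolding convex_on_def by blast
    also have "\<dots> \<le> a * (- s) + b * (- t)"
      using h by (intro add_mono mult_left_mono)
    finally show "\<psi> (a *\<^sub>R v + b *\<^sub>R w) \<le> - (a * s) - b * t" by simp
  qed
  moreover have "(0, 1) \<in> A" "(0, 0) \<in> B"
    using zero by (auto simp: A_def B_def)
  moreover have "A \<inter> B = {}"
  proof -
    have False if "\<phi> v < t" "\<psi> v \<le> - t" for v t
      using nonneg[of v] that by linarith
    then show ?thesis by (auto simp: A_def B_def)
  qed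
  ultimately obtain a b where "a \<noteq> 0"
    and sepB: "\<And>x. x \<in> B \<Longrightarrow> a \<bullet> x \<le> b" and sepA: "\<And>x. x \<in> A \<Longrightarrow> b \<le> a \<bullet> x"
    using separating_hyperplane_sets[of B A] by blast
  obtain u s where a: "a = (u, s)" by (cases a)
  have B: "u \<bullet> v - s * \<psi> v \<le> b" for v
    using sepB[of "(v, - \<psi> v)"] by (simp add: a B_def)
  have A': "b \<le> u \<bullet> v + s * t" if "\<phi> v < t" for v t
    using sepA[of "(v, t)"] that by (simp add: a A_def)
  \<comment> \<open>Letting \<open>t\<close> decrease to \<open>\<phi> v\<close> extends the bound
    from the strict epigraph to the graph.\<close>
  have A: "b \<le> u \<bullet> v + s * \<phi> v" for v
  proof (rule tendsto_lowerbound)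
    have "((\<lambda>t. u \<bullet> v + s * t) \<longlongrightarrow> u \<bullet> v + s * \<phi> v) (at (\<phi> v))"
      by (intro tendsto_intros)
    then show "((\<lambda>t. u \<bullet> v + s * t) \<longlongrightarrow> u \<bullet> v + s * \<phi> v) (at_right (\<phi> v))"
      by (rule filterlim_mono[OF _ order_refl at_le]) simp
    show "\<forall>\<^sub>F t in at_right (\<phi> v). b \<le> u \<bullet> v + s * t"
      using A' by (auto intro!: eventually_at_rightI[of _ "\<phi> v + 1"])
  qed simp
  have "b = 0"
    using A[of 0] B[of 0] zero by simp
  have "s \<ge> 0"
    using A'[of 0 1] zero \<open>b = 0\<close> by simp
  \<comment> \<open>A vertical hyperplane would bound \<open>u \<bullet> v\<close> above by
    \<open>0\<close> for every \<open>v\<close>; the choice \<open>v = u\<close> forces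
    \<open>u = 0\<close>, against \<open>a \<noteq> 0\<close>.\<close>
  moreover have "s \<noteq> 0"
  proof
    assume "s = 0"
    with B[of u] \<open>b = 0\<close> have "u \<bullet> u \<le> 0" by simp
    then have "u = 0" by (metis inner_gt_zero_iff not_less)
    with \<open>a \<noteq> 0\<close> \<open>s = 0\<close> show False
      by (simp add: a zero_prod_def)
  qed
  ultimately have "s > 0" by simp
  show ?thesis
  proof (rule that[of "- (1 / s) *\<^sub>R u"])
    fix v
    show "- (1 / s) *\<^sub>R u \<bullet> v \<le> \<phi> v" "- (- (1 / s) *\<^sub>R u \<bullet> v) \<le> \<psi> v"
      using A[of v] B[of v] \<open>b = 0\<close> \<open>s > 0\<close> by (simp_all add: field_simps)
  qed
qed

lemma convex_on_linear_perturbation: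
  fixes \<phi> :: "'i \<Rightarrow> 'a::euclidean_space \<Rightarrow> real"
  assumes "finite I" "\<And>i. i \<in> I \<Longrightarrow> convex_on UNIV (\<phi> i)" "\<And>i. i \<in> I \<Longrightarrow> 0 \<le> c i"
  shows "convex_on UNIV (\<lambda>v. (\<Sum>i\<in>I. c i * \<phi> i v) + w \<bullet> v)"
proof -
  have "convex_on UNIV (\<lambda>v. w \<bullet> v)"
    by (rule convex_onI) (auto simp: inner_right_distrib)
  moreover have "convex_on UNIV (\<lambda>v. \<Sum>i\<in>I. c i * \<phi> i v)"
    using assms by (induction I rule: finite_induct)
      (auto intro!: convex_on_add convex_on_cmul simp: convex_on_const)
  ultimately show ?thesis by (rule convex_on_add[rotated])
qed

text \<open>This is the sum rule for subdifferentials at the origin. Induction peels off one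
  function by the sandwich lemma; its subgradient, scaled by the coefficient, is absorbed into the
  linear term \<open>w\<close>, which is therefore kept arbitrary. Indices with coefficient zero
  must receive a subgradient too.\<close>

lemma subgradients_of_nonneg_combination:
  fixes \<phi> :: "'i \<Rightarrow> 'a::euclidean_space \<Rightarrow> real"
  assumes "finite I" "\<And>i. i \<in> I \<Longrightarrow> convex_on UNIV (\<phi> i)" "\<And>i. i \<in> I \<Longrightarrow> \<phi> i 0 = 0"
    and "\<And>i. i \<in> I \<Longrightarrow> 0 \<le> c i" and "\<And>v. 0 \<le> (\<Sum>i\<in>I. c i * \<phi> i v) + w \<bullet> v"
  shows "\<exists>\<xi>. (\<forall>i\<in>I. \<forall>v. \<xi> i \<bullet> v \<le> \<phi> i v) \<and> (\<Sum>i\<in>I. c i *\<^sub>R \<xi> i) + w = 0"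
  using assms
proof (induction I arbitrary: w rule: finite_induct)
  case empty
  from empty.prems(4)[of "- w"] have "w \<bullet> w \<le> 0" by simp
  then have "w = 0" by (metis inner_gt_zero_iff not_less)
  then show ?case by simp
next
  case (insert a I)
  define \<psi> where "\<psi> = (\<lambda>v. (\<Sum>i\<in>I. c i * \<phi> i v) + w \<bullet> v)"
  have \<psi>: "convex_on UNIV \<psi>"
    unfolding \<psi>_def using insert by (intro convex_on_linear_perturbation) auto
  have \<psi>0: "\<psi> 0 = 0"
    using insert.prems by (simp add: \<psi>_def)
  have ca: "convex_on UNIV (\<phi> a)" "\<phi> a 0 = 0" "0 \<le> c a"
    using insert.prems by auto
  have ge: "0 \<le> c a * \<phi> a v + \<psi> v" for v
    using insert.prems(4)[of v] insert.hyps by (simp add: \<psi>_def add.assoc)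
  obtain \<xi>a where sub: "\<And>v. \<xi>a \<bullet> v \<le> \<phi> a v" and rest: "\<And>v. 0 \<le> \<psi> v + c a * (\<xi>a \<bullet> v)"
  proof (cases "c a = 0")
    \<comment> \<open>With a zero coefficient the inequality \<open>ge\<close> says nothing about
      \<open>\<phi> a\<close>, and any subgradient will do. One exists by the sandwich of
      \<open>\<phi> a\<close> and its reflection: their sum is nonnegative by convexity at the
      midpoint \<open>0\<close>.\<close>
    case True
    have mid: "0 \<le> \<phi> a v + \<phi> a (- v)" for v
    proof -
      have "\<phi> a ((1/2) *\<^sub>R v + (1/2) *\<^sub>R (- v)) \<le> (1/2) * \<phi> a v + (1/2) * \<phi> a (- v)"
        using ca(1)[unfolded convex_on_def, THEN conjunct2, rule_format, of v "- v" "1/2" "1/2"]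
        by simp
      then show ?thesis using ca(2) by simp
    qed
    have refl: "convex_on UNIV (\<lambda>v. \<phi> a (- v))"
      unfolding convex_on_def
    proof (intro conjI convex_UNIV ballI allI impI)
      fix x y and s t :: real
      assume "0 \<le> s" "0 \<le> t" "s + t = 1"
      then have "\<phi> a (s *\<^sub>R (- x) + t *\<^sub>R (- y)) \<le> s * \<phi> a (- x) + t * \<phi> a (- y)"
        using ca(1) unfolding convex_on_def by blast
      then show "\<phi> a (- (s *\<^sub>R x + t *\<^sub>R y)) \<le> s * \<phi> a (- x) + t * \<phi> a (- y)"
        by simp
    qed
    from convex_sandwich[OF ca(1) refl _ _ mid] ca(2) obtain \<xi> where "\<And>v. \<xi> \<bullet> v \<le> \<phi> a v"
      by (metis minus_zero)
    then show ?thesis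
      using that[of \<xi>] ge True by simp
  next
    case False
    with ca have pos: "0 < c a" by simp
    have "convex_on UNIV (\<lambda>v. c a * \<phi> a v)"
      using ca by (intro convex_on_cmul)
    from convex_sandwich[OF this \<psi> _ \<psi>0 ge] ca(2) obtain \<xi>
      where \<xi>: "\<And>v. \<xi> \<bullet> v \<le> c a * \<phi> a v" "\<And>v. - (\<xi> \<bullet> v) \<le> \<psi> v"
      by auto
    show ?thesis
    proof (rule that[of "(1 / c a) *\<^sub>R \<xi>"])
      fix v
      show "(1 / c a) *\<^sub>R \<xi> \<bullet> v \<le> \<phi> a v"
        using \<xi>(1)[of v] pos by (simp add: field_simps)
      show "0 \<le> \<psi> v + c a * ((1 / c a) *\<^sub>R \<xi> \<bullet> v)"
        using \<xi>(2)[of v] pos by simp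
    qed
  qed
  have "\<exists>\<xi>. (\<forall>i\<in>I. \<forall>v. \<xi> i \<bullet> v \<le> \<phi> i v) \<and> (\<Sum>i\<in>I. c i *\<^sub>R \<xi> i) + (w + c a *\<^sub>R \<xi>a) = 0"
  proof (rule insert.IH)
    show "0 \<le> (\<Sum>i\<in>I. c i * \<phi> i v) + (w + c a *\<^sub>R \<xi>a) \<bullet> v" for v
      using rest[of v] by (simp add: \<psi>_def inner_add_left add.assoc)
  qed (use insert.prems in auto)
  then obtain \<xi> where \<xi>: "\<forall>i\<in>I. \<forall>v. \<xi> i \<bullet> v \<le> \<phi> i v"
    "(\<Sum>i\<in>I. c i *\<^sub>R \<xi> i) + (w + c a *\<^sub>R \<xi>a) = 0" by blast
  have "(\<Sum>i\<in>I. c i *\<^sub>R (\<xi>(a := \<xi>a)) i) = (\<Sum>i\<in>I. c i *\<^sub>R \<xi> i)"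
    using insert.hyps by (intro sum.cong) auto
  then show ?case
    using \<xi> sub insert.hyps by (intro exI[of _ "\<xi>(a := \<xi>a)"]) (auto simp: algebra_simps)
qed

section \<open>The quadratic penalty\<close>

text \<open>The halves make the derivatives come out as \<open>max 0 (h i z)\<close> and
  \<open>z - zbar\<close>. If \<open>zbar\<close> minimizes \<open>F\<close> over the feasible
  points nearby, the last term makes it the only minimizer among them.\<close>

definition penalty ::
  "('a::euclidean_space \<Rightarrow> real) \<Rightarrow> 'i set \<Rightarrow> ('i \<Rightarrow> 'a \<Rightarrow> real) \<Rightarrow> 'a \<Rightarrow> real \<Rightarrow> 'a \<Rightarrow> real" where
  "penalty F I h zbar c z =
     F z + c * (\<Sum>i\<in>I. (max 0 (h i z))\<^sup>2 / 2) + (z - zbar) \<bullet> (z - zbar) / 2"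

text \<open>Comparison with \<open>zbar\<close> bounds weight times violation by
  \<open>F zbar - F m\<close>, where \<open>m\<close> minimizes \<open>F\<close> on the ball. Hence
  a cluster point of the minimizers has no violation, and optimality of \<open>zbar\<close> then
  leaves no room for a positive distance. Compactness yields convergence along a subsequence of the
  weights, so the weights \<open>c\<close> are returned with the points.\<close>

lemma penalty_minimizers_tendsto:
  fixes F :: "'a::euclidean_space \<Rightarrow> real" and h :: "'i \<Rightarrow> 'a \<Rightarrow> real"
  assumes "finite I" and "0 < r"
    and contF: "continuous_on (cball zbar r) F"
    and conth: "\<And>i. i \<in> I \<Longrightarrow> continuous_on (cball zbar r) (h i)"
    and feas: "\<And>i. i \<in> I \<Longrightarrow> h i zbar \<le> 0"
    and opt: "\<And>w. w \<in> cball zbar r \<Longrightarrow> (\<And>i. i \<in> I \<Longrightarrow> h i w \<le> 0) \<Longrightarrow> F zbar \<le> F w"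
  obtains z :: "nat \<Rightarrow> 'a" and c :: "nat \<Rightarrow> real"
  where "z \<longlonglongrightarrow> zbar" "\<And>k. 0 \<le> c k" "\<And>k. z k \<in> ball zbar r"
    "\<And>k w. w \<in> cball zbar r \<Longrightarrow> penalty F I h zbar (c k) (z k) \<le> penalty F I h zbar (c k) w"
proof -
  let ?C = "cball zbar r"
  let ?P = "penalty F I h zbar"
  define Q where "Q = (\<lambda>z. \<Sum>i\<in>I. (max 0 (h i z))\<^sup>2 / 2)"
  have contQ: "continuous_on ?C Q"
    unfolding Q_def by (intro continuous_intros conth) auto
  have Q0: "0 \<le> Q z" for z
    unfolding Q_def by (intro sum_nonneg) auto
  have Pzbar: "?P c zbar = F zbar" for c
    using feas by (simp add: penalty_def max_absorb1)
  have PQ: "?P c z = F z + c * Q z + (z - zbar) \<bullet> (z - zbar) / 2" for c z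
    by (simp add: penalty_def Q_def)
  have "\<exists>z\<in>?C. \<forall>w\<in>?C. ?P c z \<le> ?P c w" for c
  proof (rule continuous_attains_inf)
    show "continuous_on ?C (?P c)"
      unfolding PQ by (intro continuous_intros contF contQ) auto
  qed (use \<open>0 < r\<close> in auto)
  then obtain z where zC: "\<And>c. z c \<in> ?C" and zmin: "\<And>c w. w \<in> ?C \<Longrightarrow> ?P c (z c) \<le> ?P c w"
    by metis
  have zbarC: "zbar \<in> ?C" using \<open>0 < r\<close> by simp
  obtain zs \<sigma> where zs: "zs \<in> ?C" and \<sigma>: "strict_mono (\<sigma> :: nat \<Rightarrow> nat)"
    and lim: "((\<lambda>k. z (real k)) \<circ> \<sigma>) \<longlonglongrightarrow> zs"
    using compact_cball[of zbar r] zC unfolding compact_def by (metis (no_types, lifting))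
  define y where "y = (\<lambda>k. z (real (\<sigma> k)))"
  have y: "y \<longlonglongrightarrow> zs"
    using lim by (simp add: y_def o_def)
  have yC: "y k \<in> ?C" for k
    using zC by (simp add: y_def)
  \<comment> \<open>\<open>zbar\<close> competes in every minimization, and both added terms vanish
    there.\<close>
  have bound: "F (y k) + real (\<sigma> k) * Q (y k) + (y k - zbar) \<bullet> (y k - zbar) / 2 \<le> F zbar" for k
    using zmin[OF zbarC, of "real (\<sigma> k)"] by (simp add: y_def PQ[symmetric] Pzbar)
  have limF: "(\<lambda>k. F (y k)) \<longlonglongrightarrow> F zs" and limQ: "(\<lambda>k. Q (y k)) \<longlonglongrightarrow> Q zs"
    using y yC zs by (auto intro!: continuous_on_tendsto_compose[OF contF]
        continuous_on_tendsto_compose[OF contQ])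
  obtain m where m: "\<And>w. w \<in> ?C \<Longrightarrow> F m \<le> F w"
    using continuous_attains_inf[OF compact_cball _ contF] zbarC by blast
  have "Q zs \<le> 0"
  proof (rule LIMSEQ_le[OF limQ])
    have "filterlim (\<lambda>k. real (\<sigma> k)) at_top sequentially"
      using filterlim_subseq[OF \<sigma>] by (rule filterlim_compose[OF filterlim_real_sequentially])
    then show "(\<lambda>k. (F zbar - F m) / real (\<sigma> k)) \<longlonglongrightarrow> 0"
      by (rule real_tendsto_divide_at_top[OF tendsto_const])
    \<comment> \<open>Since \<open>\<sigma> k \<ge> k\<close>, starting at \<open>1\<close> keeps
      the divisor positive.\<close>
    have "Q (y k) \<le> (F zbar - F m) / real (\<sigma> k)" if "k \<ge> 1" for k
    proof -
      have "0 < real (\<sigma> k)"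
        using seq_suble[OF \<sigma>, of k] that by simp
      moreover have "real (\<sigma> k) * Q (y k) \<le> F zbar - F m"
        using bound[of k] m[OF yC, of k] inner_ge_zero[of "y k - zbar"] by linarith
      ultimately show ?thesis by (simp add: field_simps)
    qed
    then show "\<exists>N. \<forall>k\<ge>N. Q (y k) \<le> (F zbar - F m) / real (\<sigma> k)" by blast
  qed
  have zs_feas: "h i zs \<le> 0" if "i \<in> I" for i
  proof -
    have "Q zs = 0" using Q0[of zs] \<open>Q zs \<le> 0\<close> by simp
    then have "(max 0 (h i zs))\<^sup>2 / 2 = 0"
      using that \<open>finite I\<close> unfolding Q_def by (subst (asm) sum_nonneg_eq_0_iff) auto
    then show ?thesis by (auto simp: max_def split: if_splits)
  qed
  \<comment> \<open>Dropping the nonnegative penalty from \<open>bound\<close> and passing to the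
    limit keeps the distance term, which \<open>F zbar \<le> F zs\<close> then forces to
    vanish.\<close>
  have "F zs + (zs - zbar) \<bullet> (zs - zbar) / 2 \<le> F zbar"
  proof (rule LIMSEQ_le_const2)
    show "(\<lambda>k. F (y k) + (y k - zbar) \<bullet> (y k - zbar) / 2) \<longlonglongrightarrow> F zs + (zs - zbar) \<bullet> (zs - zbar) / 2"
      by (intro tendsto_intros limF y) auto
    have "F (y k) + (y k - zbar) \<bullet> (y k - zbar) / 2 \<le> F zbar" for k
      using bound[of k] mult_nonneg_nonneg[OF _ Q0[of "y k"], of "real (\<sigma> k)"] by simp
    then show "\<exists>N. \<forall>k\<ge>N. F (y k) + (y k - zbar) \<bullet> (y k - zbar) / 2 \<le> F zbar" by blast
  qed
  with opt[OF zs zs_feas] have "(zs - zbar) \<bullet> (zs - zbar) \<le> 0" by simp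
  then have "zs = zbar" by (metis inner_gt_zero_iff not_less right_minus_eq)
  with y have y: "y \<longlonglongrightarrow> zbar" by simp
  \<comment> \<open>Shifting the index by \<open>N\<close> discards the finitely many minimizers
    that may lie on the boundary.\<close>
  then obtain N where N: "\<And>k. k \<ge> N \<Longrightarrow> y k \<in> ball zbar r"
    using \<open>0 < r\<close> topological_tendstoD[OF y, of "ball zbar r"]
    by (auto simp: eventually_sequentially)
  show ?thesis
  proof (rule that[of "\<lambda>k. y (k + N)" "\<lambda>k. real (\<sigma> (k + N))"])
    show "(\<lambda>k. y (k + N)) \<longlonglongrightarrow> zbar"
      using y by (rule LIMSEQ_ignore_initial_segment)
    show "y (k + N) \<in> ball zbar r" for k
      by (rule N) simp
  qed (simp_all add: y_def zmin)
qed

text \<open>Squaring removes the kink of \<open>max 0\<close> at the origin, where the difference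
  quotient is at most \<bar>s\<bar> in modulus. Since this derivative is two-sided, the chain rule
  also accepts inner functions that have only a right derivative.\<close>

lemma DERIV_max_0_square:
  "((\<lambda>s::real. (max 0 s)\<^sup>2 / 2) has_real_derivative max 0 s) (at s)"
proof -
  consider "s < 0" | "s > 0" | "s = 0" by linarith
  then show ?thesis
  proof cases
    case 1
    have "((\<lambda>s::real. 0) has_real_derivative max 0 s) (at s)" using 1 by simp
    then show ?thesis
      by (rule has_field_derivative_transform_within_open[of _ _ _ "{..<0}"]) (use 1 in auto)
  next
    case 2
    have "((\<lambda>s::real. s\<^sup>2 / 2) has_real_derivative max 0 s) (at s)"
      by (auto intro!: derivative_eq_intros simp: 2 less_imp_le)
    then show ?thesis
      by (rule has_field_derivative_transform_within_open[of _ _ _ "{0<..}"]) (use 2 in auto)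
  next
    case 3
    have "((\<lambda>s::real. (max 0 s)\<^sup>2 / 2 / s) \<longlongrightarrow> 0) (at 0)"
    proof (rule tendsto_rabs_zero_cancel, rule tendsto_sandwich[OF _ _ tendsto_const])
      show "((\<lambda>s::real. \<bar>s\<bar>) \<longlongrightarrow> 0) (at 0)"
        by (rule tendsto_rabs_zero[OF tendsto_ident_at])
      show "\<forall>\<^sub>F s::real in at 0. \<bar>(max 0 s)\<^sup>2 / 2 / s\<bar> \<le> \<bar>s\<bar>"
        by (rule always_eventually) (auto simp: max_def power2_eq_square)
    qed simp
    then show ?thesis
      using 3 by (simp add: has_field_derivative_iff)
  qed
qed

section \<open>Directional derivatives\<close>

text \<open>Sum and chain rules are available for real derivatives. Finiteness near \<open>z\<close>
  makes the extended-real quotient agree with the real one for small positive \<open>t\<close>, so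
  the directional derivative becomes a right derivative along the ray.\<close>

lemma tangentially_convex_DERIV:
  assumes tc: "tangentially_convex_at h z" and fin: "\<forall>\<^sub>F u in nhds z. \<bar>h u\<bar> \<noteq> \<infinity>"
  shows "((\<lambda>t. real_of_ereal (h (z + t *\<^sub>R v))) has_real_derivative real_of_ereal (dir_deriv h z v))
    (at_right 0)"
proof -
  have lim: "(diff_quot h z v \<longlongrightarrow> dir_deriv h z v) (at_right 0)"
    using tc tendsto_Lim[OF trivial_limit_at_right_real]
    unfolding tangentially_convex_at_def dir_deriv_exists_def dir_deriv_def by metis
  have "\<bar>dir_deriv h z v\<bar> \<noteq> \<infinity>" and hz: "\<bar>h z\<bar> \<noteq> \<infinity>"
    using tc by (auto simp: tangentially_convex_at_def)
  with lim have lim': "(diff_quot h z v \<longlongrightarrow> ereal (real_of_ereal (dir_deriv h z v))) (at_right 0)"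
    by (simp add: ereal_real')
  have "((\<lambda>t. z + t *\<^sub>R v) \<longlongrightarrow> z + 0 *\<^sub>R v) (at_right 0)"
    by (intro tendsto_intros)
  then have "\<forall>\<^sub>F t in at_right 0. \<bar>h (z + t *\<^sub>R v)\<bar> \<noteq> \<infinity>"
    using fin by (auto simp: filterlim_iff)
  moreover have "\<forall>\<^sub>F t::real in at_right 0. 0 < t"
    by (simp add: eventually_at_right_less)
  ultimately have "\<forall>\<^sub>F t in at_right 0. diff_quot h z v t =
      ereal ((real_of_ereal (h (z + t *\<^sub>R v)) - real_of_ereal (h z)) / t)"
  proof eventually_elim
    case (elim t)
    then show ?case
      using hz unfolding diff_quot_def
      by (cases "h z"; cases "h (z + t *\<^sub>R v)") auto
  qed
  from this lim' have "((\<lambda>t. ereal ((real_of_ereal (h (z + t *\<^sub>R v)) - real_of_ereal (h z)) / t))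
      \<longlongrightarrow> ereal (real_of_ereal (dir_deriv h z v))) (at_right 0)"
    by (rule tendsto_cong[THEN iffD1])
  then show ?thesis
    by (simp add: has_field_derivative_iff)
qed

lemma dir_deriv_zero:
  assumes "\<bar>h z\<bar> \<noteq> \<infinity>"
  shows "dir_deriv h z 0 = 0"
proof -
  have "diff_quot h z 0 = (\<lambda>t. 0)"
    using assms by (cases "h z") (auto simp: diff_quot_def fun_eq_iff zero_ereal_def)
  then show ?thesis
    unfolding dir_deriv_def by (auto intro: tendsto_Lim)
qed

lemma tangential_subdiffI:
  assumes "tangentially_convex_at h z" "\<And>v. \<xi> \<bullet> v \<le> real_of_ereal (dir_deriv h z v)"
  shows "\<xi> \<in> tangential_subdiff h z"
  using assms unfolding tangentially_convex_at_def tangential_subdiff_def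
  by (auto simp: ereal_le_real_iff)

text \<open>At a local minimizer the right derivatives of the penalty are nonnegative. The chain
  rule gives each constraint the factor \<open>c * max 0 (hr i z)\<close>; as this is nonnegative,
  the derivative is convex in the direction even where the penalty is not convex in
  \<open>z\<close>, and it splits into subgradients.\<close>

lemma penalty_stationarity:
  fixes F :: "'a::euclidean_space \<Rightarrow> ereal" and h :: "'i \<Rightarrow> 'a \<Rightarrow> ereal"
  defines "hr \<equiv> \<lambda>i z. real_of_ereal (h i z)"
  assumes "finite I" and c: "0 \<le> c"
    and tcF: "tangentially_convex_at F z" and finF: "\<forall>\<^sub>F u in nhds z. \<bar>F u\<bar> \<noteq> \<infinity>"
    and tch: "\<And>i. i \<in> I \<Longrightarrow> tangentially_convex_at (h i) z"
    and finh: "\<And>i. i \<in> I \<Longrightarrow> \<forall>\<^sub>F u in nhds z. \<bar>h i u\<bar> \<noteq> \<infinity>"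
    and minimal: "\<forall>\<^sub>F w in nhds z. penalty (\<lambda>z. real_of_ereal (F z)) I hr zbar c z
      \<le> penalty (\<lambda>z. real_of_ereal (F z)) I hr zbar c w"
  obtains \<xi>0 \<xi> where "\<xi>0 \<in> tangential_subdiff F z" "\<And>i. i \<in> I \<Longrightarrow> \<xi> i \<in> tangential_subdiff (h i) z"
    "\<xi>0 + (\<Sum>i\<in>I. (c * max 0 (hr i z)) *\<^sub>R \<xi> i) = zbar - z"
proof -
  let ?P = "penalty (\<lambda>z. real_of_ereal (F z)) I hr zbar c"
  define D0 where "D0 = (\<lambda>v. real_of_ereal (dir_deriv F z v))"
  define D where "D = (\<lambda>i v. real_of_ereal (dir_deriv (h i) z v))"
  have nonneg: "0 \<le> D0 v + (\<Sum>i\<in>I. (c * max 0 (hr i z)) * D i v) + (z - zbar) \<bullet> v" for v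
  proof -
    have "((\<lambda>t. (max 0 (hr i (z + t *\<^sub>R v)))\<^sup>2 / 2) has_real_derivative max 0 (hr i z) * D i v)
        (at_right 0)" if "i \<in> I" for i
      using DERIV_chain2[OF DERIV_max_0_square tangentially_convex_DERIV[OF tch finh, OF that that]]
      by (simp add: hr_def D_def)
    moreover have "((\<lambda>t. real_of_ereal (F (z + t *\<^sub>R v))) has_real_derivative D0 v) (at_right 0)"
      unfolding D0_def by (rule tangentially_convex_DERIV[OF tcF finF])
    moreover have "((\<lambda>t. (z + t *\<^sub>R v - zbar) \<bullet> (z + t *\<^sub>R v - zbar) / 2) has_real_derivative
        (z - zbar) \<bullet> v) (at_right 0)"
    proof -
      \<comment> \<open>Along the ray the distance term is a polynomial in \<open>t\<close>; its
        linear coefficient is the derivative at \<open>0\<close>.\<close>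
      have "(\<lambda>t. (z + t *\<^sub>R v - zbar) \<bullet> (z + t *\<^sub>R v - zbar) / 2) =
          (\<lambda>t. (z - zbar) \<bullet> (z - zbar) / 2 + t * ((z - zbar) \<bullet> v) + t\<^sup>2 * (v \<bullet> v) / 2)"
        by (rule ext) (simp add: field_simps inner_diff_left inner_diff_right inner_add_left
            inner_add_right inner_commute power2_eq_square)
      then show ?thesis
        by (auto intro!: derivative_eq_intros)
    qed
    ultimately have "((\<lambda>t. ?P (z + t *\<^sub>R v)) has_real_derivative
        D0 v + c * (\<Sum>i\<in>I. max 0 (hr i z) * D i v) + (z - zbar) \<bullet> v) (at_right 0)"
      unfolding penalty_def by (intro DERIV_add DERIV_cmult DERIV_sum) auto
    then have lim: "((\<lambda>t. (?P (z + t *\<^sub>R v) - ?P z) / t) \<longlongrightarrow>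
        D0 v + c * (\<Sum>i\<in>I. max 0 (hr i z) * D i v) + (z - zbar) \<bullet> v) (at_right 0)"
      by (simp add: has_field_derivative_iff)
    have "((\<lambda>t. z + t *\<^sub>R v) \<longlongrightarrow> z + 0 *\<^sub>R v) (at_right 0)"
      by (intro tendsto_intros)
    then have "\<forall>\<^sub>F t in at_right 0. ?P z \<le> ?P (z + t *\<^sub>R v)"
      using minimal by (auto simp: filterlim_iff)
    moreover have "\<forall>\<^sub>F t::real in at_right 0. 0 < t"
      by (simp add: eventually_at_right_less)
    ultimately have "\<forall>\<^sub>F t in at_right 0. 0 \<le> (?P (z + t *\<^sub>R v) - ?P z) / t"
      by eventually_elim simp
    from tendsto_lowerbound[OF lim this] show ?thesis
      by (simp add: sum_distrib_left mult.assoc)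
  qed
  \<comment> \<open>\<open>None\<close> stands for the objective, with coefficient \<open>1\<close>,
    so that objective and constraints form one finite family.\<close>
  define c' where "c' = (\<lambda>i. case i of None \<Rightarrow> 1 | Some i \<Rightarrow> c * max 0 (hr i z))"
  define D' where "D' = (\<lambda>i. case i of None \<Rightarrow> D0 | Some i \<Rightarrow> D i)"
  let ?J = "insert None (Some ` I)"
  have sum_J: "sum e ?J = e None + (\<Sum>i\<in>I. e (Some i))" for e :: "'i option \<Rightarrow> 'b::ab_group_add"
    using \<open>finite I\<close> by (subst sum.insert) (auto simp: sum.reindex)
  have "\<exists>\<xi>. (\<forall>i\<in>?J. \<forall>v. \<xi> i \<bullet> v \<le> D' i v) \<and> (\<Sum>i\<in>?J. c' i *\<^sub>R \<xi> i) + (z - zbar) = 0"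
  proof (rule subgradients_of_nonneg_combination)
    show "convex_on UNIV (D' i)" if "i \<in> ?J" for i
      using that tcF tch by (auto simp: D'_def D0_def D_def tangentially_convex_at_def)
    show "D' i 0 = 0" if "i \<in> ?J" for i
      using that tcF tch
      by (auto simp: D'_def D0_def D_def tangentially_convex_at_def dir_deriv_zero)
    show "0 \<le> c' i" if "i \<in> ?J" for i
      using that c by (auto simp: c'_def)
    show "0 \<le> (\<Sum>i\<in>?J. c' i * D' i v) + (z - zbar) \<bullet> v" for v
      using nonneg[of v] by (simp only: sum_J) (simp add: c'_def D'_def)
  qed (use \<open>finite I\<close> in simp)
  then obtain \<xi> where \<xi>: "\<And>i v. i \<in> ?J \<Longrightarrow> \<xi> i \<bullet> v \<le> D' i v"
    "(\<Sum>i\<in>?J. c' i *\<^sub>R \<xi> i) + (z - zbar) = 0" by blast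
  show ?thesis
  proof (rule that[of "\<xi> None" "\<lambda>i. \<xi> (Some i)"])
    show "\<xi> None \<in> tangential_subdiff F z"
      using \<xi>(1)[of None] by (intro tangential_subdiffI[OF tcF]) (auto simp: D'_def D0_def)
    show "\<xi> (Some i) \<in> tangential_subdiff (h i) z" if "i \<in> I" for i
      using \<xi>(1)[of "Some i"] that
      by (intro tangential_subdiffI[OF tch]) (auto simp: D'_def D_def)
    show "\<xi> None + (\<Sum>i\<in>I. (c * max 0 (hr i z)) *\<^sub>R \<xi> (Some i)) = zbar - z"
      using \<xi>(2) by (simp only: sum_J) (simp add: c'_def algebra_simps)
  qed
qed

section \<open>The sequential Fritz--John condition\<close>

lemma locally_lipschitz_around_isCont:
  assumes "locally_lipschitz_around h z"
  shows "\<forall>\<^sub>F u in nhds z. \<bar>h u\<bar> \<noteq> \<infinity> \<and> isCont (\<lambda>u. real_of_ereal (h u)) u"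
proof -
  obtain \<epsilon> L where \<epsilon>: "0 < \<epsilon>" "\<forall>u\<in>ball z \<epsilon>. \<bar>h u\<bar> \<noteq> \<infinity>"
    "L-lipschitz_on (ball z \<epsilon>) (\<lambda>u. real_of_ereal (h u))"
    using assms unfolding locally_lipschitz_around_def by blast
  from lipschitz_on_continuous_on[OF \<epsilon>(3)]
  have "\<forall>u\<in>ball z \<epsilon>. isCont (\<lambda>u. real_of_ereal (h u)) u"
    by (simp add: continuous_on_eq_continuous_at)
  then show ?thesis
    using \<epsilon> by (auto simp: eventually_nhds intro!: exI[of _ "ball z \<epsilon>"])
qed

lemma min_ereal_uminus: "min (ereal a) (- ereal b) = ereal (min a (- b))"
  by (simp add: min_def)

text \<open>The penalty minimizers are stationary with multipliers \<open>1\<close> and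
  \<open>a k i\<close> up to the residual \<open>zbar - z k\<close>; dividing by the Euclidean norm
  of the multipliers normalizes them. The constraints are extended-real so that the gap function can
  be one of them.\<close>

lemma sequential_fritz_john:
  fixes F :: "'a::euclidean_space \<Rightarrow> ereal" and h :: "'i \<Rightarrow> 'a \<Rightarrow> ereal"
  assumes "finite I"
    and F: "locally_lipschitz_around F zbar" "tangentially_convex_around F zbar"
    and h: "\<And>i. i \<in> I \<Longrightarrow> locally_lipschitz_around (h i) zbar"
      "\<And>i. i \<in> I \<Longrightarrow> tangentially_convex_around (h i) zbar"
    and feas: "\<And>i. i \<in> I \<Longrightarrow> h i zbar \<le> 0"
    and opt: "\<forall>\<^sub>F w in nhds zbar. (\<forall>i\<in>I. h i w \<le> 0) \<longrightarrow> F zbar \<le> F w"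
  obtains z :: "nat \<Rightarrow> 'a" and \<mu> :: "nat \<Rightarrow> real" and \<alpha> :: "nat \<Rightarrow> 'i \<Rightarrow> real"
    and \<xi>0 :: "nat \<Rightarrow> 'a" and \<xi> :: "nat \<Rightarrow> 'i \<Rightarrow> 'a"
  where "z \<longlonglongrightarrow> zbar" "\<And>k. 0 \<le> \<mu> k" "\<And>k i. 0 \<le> \<alpha> k i"
    "\<And>k. \<xi>0 k \<in> tangential_subdiff F (z k)"
    "\<And>k i. i \<in> I \<Longrightarrow> \<xi> k i \<in> tangential_subdiff (h i) (z k)"
    "(\<lambda>k. norm (\<mu> k *\<^sub>R \<xi>0 k + (\<Sum>i\<in>I. \<alpha> k i *\<^sub>R \<xi> k i))) \<longlonglongrightarrow> 0"
    "\<And>i. i \<in> I \<Longrightarrow> (\<lambda>k. min (ereal (\<alpha> k i)) (- h i (z k))) \<longlonglongrightarrow> 0"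
    "\<And>k. (\<mu> k)\<^sup>2 + (\<Sum>i\<in>I. (\<alpha> k i)\<^sup>2) = 1"
proof -
  define Fr where "Fr = (\<lambda>z. real_of_ereal (F z))"
  define hr where "hr = (\<lambda>i z. real_of_ereal (h i z))"
  \<comment> \<open>The local hypotheses become pointwise properties, and finiteness of
    \<open>I\<close> lets one radius serve all functions.\<close>
  define good where "good = (\<lambda>(\<phi> :: 'a \<Rightarrow> ereal) u.
    (\<bar>\<phi> u\<bar> \<noteq> \<infinity> \<and> isCont (\<lambda>u. real_of_ereal (\<phi> u)) u) \<and> tangentially_convex_at \<phi> u)"
  have good: "\<forall>\<^sub>F u in nhds zbar. good \<phi> u"
    if "locally_lipschitz_around \<phi> zbar" "tangentially_convex_around \<phi> zbar" for \<phi>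
    using locally_lipschitz_around_isCont[OF that(1)] that(2)[unfolded tangentially_convex_around_def]
    by eventually_elim (simp add: good_def)
  have "\<forall>\<^sub>F u in nhds zbar. good F u"
    using F by (rule good)
  moreover have "\<forall>\<^sub>F u in nhds zbar. \<forall>i\<in>I. good (h i) u"
    using good h \<open>finite I\<close> by (intro eventually_ball_finite) auto
  ultimately have "\<forall>\<^sub>F u in nhds zbar. good F u \<and> (\<forall>i\<in>I. good (h i) u) \<and>
      ((\<forall>i\<in>I. h i u \<le> 0) \<longrightarrow> F zbar \<le> F u)"
    using opt by eventually_elim blast
  then obtain r0 where "0 < r0" and r0: "\<And>u. dist u zbar < r0 \<Longrightarrow> good F u \<and>
      (\<forall>i\<in>I. good (h i) u) \<and> ((\<forall>i\<in>I. h i u \<le> 0) \<longrightarrow> F zbar \<le> F u)"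
    unfolding eventually_nhds_metric by blast
  \<comment> \<open>Halving puts the closed ball, over which the penalty is minimized, inside the
    open ball of radius \<open>r0\<close>.\<close>
  define r where "r = r0 / 2"
  have "0 < r" using \<open>0 < r0\<close> by (simp add: r_def)
  have ball: "good F u" "\<And>i. i \<in> I \<Longrightarrow> good (h i) u"
    "(\<And>i. i \<in> I \<Longrightarrow> h i u \<le> 0) \<Longrightarrow> F zbar \<le> F u" if "u \<in> cball zbar r" for u
    using r0[of u] that \<open>0 < r0\<close> by (auto simp: r_def dist_commute)
  have hr: "h i u = ereal (hr i u)" if "i \<in> I" "u \<in> cball zbar r" for i u
    using ball(2)[OF that(2,1)] by (simp add: good_def hr_def ereal_real')
  have Fr: "F u = ereal (Fr u)" if "u \<in> cball zbar r" for u
    using ball(1)[OF that] by (simp add: good_def Fr_def ereal_real')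
  have zbar: "zbar \<in> cball zbar r" using \<open>0 < r\<close> by simp
  have contF: "continuous_on (cball zbar r) Fr"
    using ball(1) unfolding good_def Fr_def by (intro continuous_at_imp_continuous_on) auto
  have conth: "continuous_on (cball zbar r) (hr i)" if "i \<in> I" for i
    using ball(2) that unfolding good_def hr_def
    by (intro continuous_at_imp_continuous_on) auto
  have feas': "hr i zbar \<le> 0" if "i \<in> I" for i
    using feas[OF that] hr[OF that zbar] by simp
  have opt': "Fr zbar \<le> Fr w" if "w \<in> cball zbar r" "\<And>i. i \<in> I \<Longrightarrow> hr i w \<le> 0" for w
    using ball(3)[OF that(1)] that hr Fr[OF that(1)] Fr[OF zbar] by simp
  obtain z :: "nat \<Rightarrow> 'a" and c :: "nat \<Rightarrow> real"
    where z: "z \<longlonglongrightarrow> zbar" and c: "\<And>k. 0 \<le> c k" and zr: "\<And>k. z k \<in> ball zbar r"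
      and zmin: "\<And>k w. w \<in> cball zbar r \<Longrightarrow>
        penalty Fr I hr zbar (c k) (z k) \<le> penalty Fr I hr zbar (c k) w"
  proof (rule penalty_minimizers_tendsto[where h = hr, OF \<open>finite I\<close> \<open>0 < r\<close> contF])
    show "continuous_on (cball zbar r) (hr i)" if "i \<in> I" for i
      using that by (rule conth)
    show "hr i zbar \<le> 0" if "i \<in> I" for i
      using that by (rule feas')
    show "Fr zbar \<le> Fr w" if "w \<in> cball zbar r" "\<And>i. i \<in> I \<Longrightarrow> hr i w \<le> 0" for w
      using that by (rule opt')
  qed (rule that)
  have zr': "z k \<in> cball zbar r" for k
    using zr[of k] by simp
  define a where "a = (\<lambda>k i. c k * max 0 (hr i (z k)))"
  have a0: "0 \<le> a k i" for k i
    using c by (simp add: a_def)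
  have "\<exists>\<xi>0 \<xi>. \<xi>0 \<in> tangential_subdiff F (z k) \<and> (\<forall>i\<in>I. \<xi> i \<in> tangential_subdiff (h i) (z k)) \<and>
      \<xi>0 + (\<Sum>i\<in>I. a k i *\<^sub>R \<xi> i) = zbar - z k" for k
  proof -
    \<comment> \<open>Each \<open>z k\<close> lies in the open ball, so minimality over the closed
      ball is local minimality at \<open>z k\<close>.\<close>
    have near: "\<forall>\<^sub>F u in nhds (z k). u \<in> cball zbar r"
      unfolding eventually_nhds using zr[of k] by (intro exI[of _ "ball zbar r"]) auto
    have tcF: "tangentially_convex_at F (z k)"
      using ball(1)[OF zr'[of k]] by (simp add: good_def)
    have finF: "\<forall>\<^sub>F u in nhds (z k). \<bar>F u\<bar> \<noteq> \<infinity>"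
      using near by eventually_elim (use ball(1) in \<open>auto simp: good_def\<close>)
    have tch: "tangentially_convex_at (h i) (z k)" if "i \<in> I" for i
      using ball(2)[OF zr' that] by (simp add: good_def)
    have finh: "\<forall>\<^sub>F u in nhds (z k). \<bar>h i u\<bar> \<noteq> \<infinity>" if "i \<in> I" for i
      using near by eventually_elim (use ball(2) that in \<open>auto simp: good_def\<close>)
    have "\<forall>\<^sub>F w in nhds (z k). penalty Fr I hr zbar (c k) (z k)
        \<le> penalty Fr I hr zbar (c k) w"
      using near by eventually_elim (rule zmin)
    then show ?thesis
      unfolding a_def Fr_def hr_def
      by (rule penalty_stationarity[OF \<open>finite I\<close> c tcF finF, rotated 2])
        (auto intro: tch finh)
  qed
  then obtain \<xi>0 \<xi> where \<xi>0: "\<And>k. \<xi>0 k \<in> tangential_subdiff F (z k)"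
    and \<xi>: "\<And>k i. i \<in> I \<Longrightarrow> \<xi> k i \<in> tangential_subdiff (h i) (z k)"
    and stat: "\<And>k. \<xi>0 k + (\<Sum>i\<in>I. a k i *\<^sub>R \<xi> k i) = zbar - z k"
    by metis
  \<comment> \<open>\<open>N k\<close> is the Euclidean norm of the multiplier vector. The objective
    contributes the entry \<open>1\<close>, so \<open>N k \<ge> 1\<close> and the division cannot
    enlarge the residual.\<close>
  define N where "N = (\<lambda>k. sqrt (1 + (\<Sum>i\<in>I. (a k i)\<^sup>2)))"
  have N1: "1 \<le> N k" for k
    by (simp add: N_def sum_nonneg)
  have N2: "(N k)\<^sup>2 = 1 + (\<Sum>i\<in>I. (a k i)\<^sup>2)" for k
    by (simp add: N_def sum_nonneg add_nonneg_nonneg)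
  have N0: "N k > 0" for k using N1[of k] by linarith
  show ?thesis
  proof (rule that[of z "\<lambda>k. 1 / N k" "\<lambda>k i. a k i / N k" \<xi>0 \<xi>])
    have norm_eq: "norm ((1 / N k) *\<^sub>R \<xi>0 k + (\<Sum>i\<in>I. (a k i / N k) *\<^sub>R \<xi> k i))
        = norm (z k - zbar) / N k" for k
    proof -
      have "(1 / N k) *\<^sub>R \<xi>0 k + (\<Sum>i\<in>I. (a k i / N k) *\<^sub>R \<xi> k i) = (1 / N k) *\<^sub>R (zbar - z k)"
        unfolding stat[symmetric] by (simp add: scaleR_add_right scaleR_sum_right)
      then show ?thesis using N0[of k] by (simp add: norm_minus_commute)
    qed
    have "(\<lambda>k. norm (z k - zbar)) \<longlonglongrightarrow> 0"
      using z by (simp add: LIM_zero tendsto_norm_zero)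
    then show "(\<lambda>k. norm ((1 / N k) *\<^sub>R \<xi>0 k + (\<Sum>i\<in>I. (a k i / N k) *\<^sub>R \<xi> k i))) \<longlonglongrightarrow> 0"
      unfolding norm_eq
    proof (rule tendsto_sandwich[OF _ _ tendsto_const, rotated 2])
      show "\<forall>\<^sub>F k in sequentially. norm (z k - zbar) / N k \<le> norm (z k - zbar)"
        using N1 N0 by (intro always_eventually allI) (simp add: divide_le_eq mult_le_cancel_left1)
    qed (use N0 in \<open>auto simp: less_imp_le\<close>)
    show "(\<lambda>k. min (ereal (a k i / N k)) (- h i (z k))) \<longlonglongrightarrow> 0" if "i \<in> I" for i
    proof -
      text \<open>Since \<open>a k i\<close> vanishes unless \<open>h i (z k) > 0\<close>, the minimum is minus the violation.\<close>
      have "min (ereal (a k i / N k)) (- h i (z k)) = ereal (- max 0 (hr i (z k)))" for k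
      proof -
        have "min (a k i / N k) (- hr i (z k)) = - max 0 (hr i (z k))"
        proof (cases "hr i (z k) \<le> 0")
          case True
          then show ?thesis by (simp add: a_def max_absorb1)
        next
          case False
          moreover have "0 \<le> a k i / N k"
            using a0[of k i] N0[of k] by simp
          ultimately show ?thesis by linarith
        qed
        then show ?thesis
          by (simp only: hr[OF that zr'] min_ereal_uminus)
      qed
      moreover have "(\<lambda>k. hr i (z k)) \<longlonglongrightarrow> hr i zbar"
        using z zbar zr' by (auto intro!: continuous_on_tendsto_compose[OF conth[OF that]])
      then have "(\<lambda>k. ereal (- max 0 (hr i (z k)))) \<longlonglongrightarrow> ereal (- max 0 (hr i zbar))"
        by (intro tendsto_intros)
      ultimately show ?thesis
        using feas'[OF that] by (simp add: max_absorb1 flip: zero_ereal_def)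
    qed
    show "(1 / N k)\<^sup>2 + (\<Sum>i\<in>I. (a k i / N k)\<^sup>2) = 1" for k
      using N0[of k]
      by (simp add: power_divide sum_divide_distrib[symmetric] add_divide_distrib[symmetric]
          N2[symmetric])
  qed (use z N0 a0 \<xi>0 \<xi> in \<open>auto simp: less_imp_le\<close>)
qed

section \<open>The normal cone of the whole space and the bilevel problem\<close>

lemma limiting_normal_cone_UNIV:
  "limiting_normal_cone UNIV z = {0 :: 'a::euclidean_space}"
proof -
  have frechet: "frechet_normal_cone UNIV u = {0}" for u :: 'a
  proof (intro subset_antisym subsetI)
    fix \<xi> assume \<xi>: "\<xi> \<in> frechet_normal_cone UNIV u"
    show "\<xi> \<in> {0}"
    proof (rule ccontr)
      assume "\<xi> \<notin> {0}"
      then have "norm \<xi> > 0" by simp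
      then have "\<forall>\<^sub>F w in at u. \<xi> \<bullet> (w - u) \<le> (norm \<xi> / 2) * norm (w - u)"
        using \<xi> unfolding frechet_normal_cone_def by (auto dest!: spec[of _ "norm \<xi> / 2"])
      then obtain d where d: "0 < d" "\<And>w. w \<noteq> u \<Longrightarrow> dist w u < d \<Longrightarrow>
          \<xi> \<bullet> (w - u) \<le> (norm \<xi> / 2) * norm (w - u)"
        unfolding eventually_at by blast
      \<comment> \<open>The step from \<open>u\<close> along \<open>\<xi>\<close> has length
        \<open>d / 2\<close>. It gives \<open>\<xi> \<bullet> (t *\<^sub>R \<xi>) = t * (norm
        \<xi>)\<^sup>2\<close>, twice what normality with \<open>\<epsilon> = norm \<xi> / 2\<close>
        permits.\<close>
      define t where "t = d / (2 * norm \<xi>)"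
      have t: "0 < t" "t * norm \<xi> < d"
        using d(1) \<open>norm \<xi> > 0\<close> by (simp_all add: t_def)
      have "\<xi> \<bullet> (t *\<^sub>R \<xi>) \<le> (norm \<xi> / 2) * norm (t *\<^sub>R \<xi>)"
        using d(2)[of "u + t *\<^sub>R \<xi>"] t \<open>norm \<xi> > 0\<close> by (simp add: dist_norm)
      with t \<open>norm \<xi> > 0\<close> show False
        by (simp add: power2_norm_eq_inner[symmetric] power2_eq_square)
    qed
  qed (auto simp: frechet_normal_cone_def)
  show ?thesis
    unfolding limiting_normal_cone_def frechet
  proof (intro subset_antisym subsetI)
    fix \<xi> :: 'a
    assume "\<xi> \<in> {\<xi>. \<exists>u \<nu>. (\<forall>k. u k \<in> UNIV) \<and> u \<longlonglongrightarrow> z \<and> \<nu> \<longlonglongrightarrow> \<xi> \<and> (\<forall>k. \<nu> k \<in> {0})}"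
    then obtain \<nu> :: "nat \<Rightarrow> 'a" where "\<nu> \<longlonglongrightarrow> \<xi>" "\<forall>k. \<nu> k = 0" by auto
    then show "\<xi> \<in> {0}" by (simp add: LIMSEQ_const_iff fun_eq_iff[of \<nu> "\<lambda>_. 0", symmetric])
  next
    fix \<xi> :: 'a
    assume "\<xi> \<in> {0}"
    then show "\<xi> \<in> {\<xi>. \<exists>u \<nu>. (\<forall>k. u k \<in> UNIV) \<and> u \<longlonglongrightarrow> z \<and> \<nu> \<longlonglongrightarrow> \<xi> \<and> (\<forall>k. \<nu> k \<in> {0})}"
      by (intro CollectI exI[of _ "\<lambda>_. z"] exI[of _ "\<lambda>_. 0"]) auto
  qed
qed

text \<open>A nonpositive gap says that \<open>f\<close> at the point is a lower bound of all
  feasible lower-level values; together with lower-level feasibility this is optimality.\<close>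

lemma value_feasible_eq_bilevel_feasible:
  "value_feasible p G q g f = bilevel_feasible p G q g f"
proof -
  \<comment> \<open>Infinite values are harmless: both sides hold when the value function is
    \<open>\<infinity>\<close>, and both fail when it is \<open>-\<infinity>\<close>.\<close>
  have gap: "gap_fun q g f (x, y) \<le> 0 \<longleftrightarrow> ereal (f (x, y)) \<le> value_fun q g f x" for x y
    by (cases "value_fun q g f x") (auto simp: gap_fun_def)
  show ?thesis
    unfolding value_feasible_def bilevel_feasible_def lower_solutions_def
    by (auto simp: gap) (auto simp: value_fun_def le_INF_iff lower_feasible_def)
qed

theorem theorem13:
  fixes F f :: "(real ^ 'n) \<times> (real ^ 'm) \<Rightarrow> real"
    and G g :: "nat \<Rightarrow> (real ^ 'n) \<times> (real ^ 'm) \<Rightarrow> real"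
    and p q :: nat
    and xbar :: "real ^ 'n" and ybar :: "real ^ 'm"
    and V :: "real ^ 'n \<Rightarrow> ereal"
    and H :: "(real ^ 'n) \<times> (real ^ 'm) \<Rightarrow> ereal"
    and \<Xi> :: "((real ^ 'n) \<times> (real ^ 'm)) set"
  defines "V \<equiv> value_fun q g f"
    and "H \<equiv> gap_fun q g f"
    and "\<Xi> \<equiv> value_feasible p G q g f"
  assumes "local_minimizer_on F (bilevel_feasible p G q g f) (xbar, ybar)"
    and "convex (contingent_cone \<Xi> (xbar, ybar))"
    and "locally_lipschitz_around (\<lambda>z. ereal (F z)) (xbar, ybar)"
    and "tangentially_convex_around (\<lambda>z. ereal (F z)) (xbar, ybar)"
    and "locally_lipschitz_around H (xbar, ybar)"
    and "tangentially_convex_around H (xbar, ybar)"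
    and "\<forall>i\<in>{1..q}. locally_lipschitz_around (\<lambda>z. ereal (g i z)) (xbar, ybar)"
    and "\<forall>i\<in>{1..q}. tangentially_convex_around (\<lambda>z. ereal (g i z)) (xbar, ybar)"
    and "\<forall>j\<in>{1..p}. locally_lipschitz_around (\<lambda>z. ereal (G j z)) (xbar, ybar)"
    and "\<forall>j\<in>{1..p}. tangentially_convex_around (\<lambda>z. ereal (G j z)) (xbar, ybar)"
    and "locally_lipschitz_around V xbar"
    and "tangentially_convex_around V xbar"
  shows "\<exists>(z :: nat \<Rightarrow> (real ^ 'n) \<times> (real ^ 'm))
          (\<mu>0 :: nat \<Rightarrow> real) (lam :: nat \<Rightarrow> real)
          (\<alpha> :: nat \<Rightarrow> nat \<Rightarrow> real) (\<beta> :: nat \<Rightarrow> nat \<Rightarrow> real)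
          (\<xi>F :: nat \<Rightarrow> (real ^ 'n) \<times> (real ^ 'm)) (\<xi>H :: nat \<Rightarrow> (real ^ 'n) \<times> (real ^ 'm))
          (\<xi> :: nat \<Rightarrow> nat \<Rightarrow> (real ^ 'n) \<times> (real ^ 'm))
          (\<zeta> :: nat \<Rightarrow> nat \<Rightarrow> (real ^ 'n) \<times> (real ^ 'm))
          (\<eta> :: nat \<Rightarrow> (real ^ 'n) \<times> (real ^ 'm)).
      z \<longlonglongrightarrow> (xbar, ybar) \<and>
      (\<forall>k. \<mu>0 k \<ge> 0 \<and> lam k \<ge> 0 \<and> (\<forall>i\<in>{1..q}. \<alpha> k i \<ge> 0) \<and> (\<forall>j\<in>{1..p}. \<beta> k j \<ge> 0)) \<and>
      (\<forall>k. \<xi>F k \<in> tangential_subdiff (\<lambda>z. ereal (F z)) (z k)) \<and>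
      (\<forall>k. \<xi>H k \<in> tangential_subdiff H (z k)) \<and>
      (\<forall>k. \<forall>i\<in>{1..q}. \<xi> k i \<in> tangential_subdiff (\<lambda>z. ereal (g i z)) (z k)) \<and>
      (\<forall>k. \<forall>j\<in>{1..p}. \<zeta> k j \<in> tangential_subdiff (\<lambda>z. ereal (G j z)) (z k)) \<and>
      (\<forall>k. \<eta> k \<in> limiting_normal_cone UNIV (z k) \<and> limiting_normal_cone UNIV (z k) = {0}) \<and>
      (\<lambda>k. norm (\<mu>0 k *\<^sub>R \<xi>F k + lam k *\<^sub>R \<xi>H k + (\<Sum>i=1..q. \<alpha> k i *\<^sub>R \<xi> k i)
                   + (\<Sum>j=1..p. \<beta> k j *\<^sub>R \<zeta> k j) + \<eta> k)) \<longlonglongrightarrow> 0 \<and>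
      (\<lambda>k. min (ereal (lam k)) (- H (z k))) \<longlonglongrightarrow> 0 \<and>
      (\<forall>i\<in>{1..q}. (\<lambda>k. min (\<alpha> k i) (- g i (z k))) \<longlonglongrightarrow> 0) \<and>
      (\<forall>j\<in>{1..p}. (\<lambda>k. min (\<beta> k j) (- G j (z k))) \<longlonglongrightarrow> 0) \<and>
      (\<forall>k. (\<mu>0 k)\<^sup>2 + (lam k)\<^sup>2 + (\<Sum>i=1..q. (\<alpha> k i)\<^sup>2) + (\<Sum>j=1..p. (\<beta> k j)\<^sup>2) = 1)"
proof -
  let ?zbar = "(xbar, ybar)"
  \<comment> \<open>The three groups of constraints become one family: \<open>None\<close> is the
    value-function constraint, \<open>Inl\<close> marks the \<open>g i\<close>, \<open>Inr\<close>
    the \<open>G j\<close>.\<close>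
  define h :: "(nat + nat) option \<Rightarrow> (real ^ 'n) \<times> (real ^ 'm) \<Rightarrow> ereal" where
    "h = (\<lambda>i. case i of None \<Rightarrow> H | Some (Inl i) \<Rightarrow> \<lambda>z. ereal (g i z)
                | Some (Inr j) \<Rightarrow> \<lambda>z. ereal (G j z))"
  define I where "I = insert None (Some ` ({1..q} <+> {1..p}))"
  have h_simps: "h None = H" "h (Some (Inl i)) = (\<lambda>z. ereal (g i z))"
    "h (Some (Inr i)) = (\<lambda>z. ereal (G i z))" for i
    by (simp_all add: h_def)
  have sum_I: "sum e I = e None + (\<Sum>i=1..q. e (Some (Inl i))) + (\<Sum>j=1..p. e (Some (Inr j)))"
    for e :: "(nat + nat) option \<Rightarrow> 'b::ab_group_add"
    unfolding I_def by (subst sum.insert) (auto simp: sum.reindex sum.Plus add.assoc)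
  have I_iff: "(\<forall>i\<in>I. P i) \<longleftrightarrow> P None \<and> (\<forall>i\<in>{1..q}. P (Some (Inl i))) \<and>
      (\<forall>j\<in>{1..p}. P (Some (Inr j)))" for P
    by (auto simp: I_def)
  \<comment> \<open>Local optimality is given on the bilevel feasible set; the equality of the
    feasible sets carries it over to the family \<open>h\<close>.\<close>
  have feasible: "z \<in> bilevel_feasible p G q g f \<longleftrightarrow> (\<forall>i\<in>I. h i z \<le> 0)" for z
    unfolding value_feasible_eq_bilevel_feasible[symmetric] value_feasible_def I_iff
    by (simp add: h_simps H_def)
  have "finite I" by (simp add: I_def)
  have lip: "locally_lipschitz_around (h i) ?zbar" if "i \<in> I" for i
    using that assms(8,10,12) by (auto simp: I_def h_simps)
  have tc: "tangentially_convex_around (h i) ?zbar" if "i \<in> I" for i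
    using that assms(9,11,13) by (auto simp: I_def h_simps)
  have zbar: "h i ?zbar \<le> 0" if "i \<in> I" for i
    using assms(4) that feasible by (auto simp: local_minimizer_on_def)
  have opt: "\<forall>\<^sub>F w in nhds ?zbar. (\<forall>i\<in>I. h i w \<le> 0) \<longrightarrow> ereal (F ?zbar) \<le> ereal (F w)"
    using assms(4) unfolding local_minimizer_on_def eventually_nhds feasible[symmetric] by auto
  obtain z \<mu> \<alpha> \<xi>0 \<xi> where z: "z \<longlonglongrightarrow> ?zbar" and nonneg: "\<And>k. 0 \<le> \<mu> k" "\<And>k i. 0 \<le> \<alpha> k i"
    and \<xi>0: "\<And>k. \<xi>0 k \<in> tangential_subdiff (\<lambda>z. ereal (F z)) (z k)"
    and \<xi>: "\<And>k i. i \<in> I \<Longrightarrow> \<xi> k i \<in> tangential_subdiff (h i) (z k)"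
    and stat: "(\<lambda>k. norm (\<mu> k *\<^sub>R \<xi>0 k + (\<Sum>i\<in>I. \<alpha> k i *\<^sub>R \<xi> k i))) \<longlonglongrightarrow> 0"
    and compl: "\<And>i. i \<in> I \<Longrightarrow> (\<lambda>k. min (ereal (\<alpha> k i)) (- h i (z k))) \<longlonglongrightarrow> 0"
    and normed: "\<And>k. (\<mu> k)\<^sup>2 + (\<Sum>i\<in>I. (\<alpha> k i)\<^sup>2) = 1"
    using sequential_fritz_john[OF \<open>finite I\<close> assms(6,7) lip tc zbar opt] by blast
  have \<xi>': "\<forall>i\<in>I. \<xi> k i \<in> tangential_subdiff (h i) (z k)" for k
    using \<xi> by blast
  have compl': "\<forall>i\<in>I. (\<lambda>k. min (ereal (\<alpha> k i)) (- h i (z k))) \<longlonglongrightarrow> 0"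
    using compl by blast
  \<comment> \<open>Complementarity is obtained in the extended reals; for the real-valued
    \<open>g i\<close> and \<open>G j\<close> it is brought back to the reals.\<close>
  have lim_min: "(\<lambda>k. min (ereal (s k)) (- ereal (t k))) \<longlonglongrightarrow> 0 \<longleftrightarrow> (\<lambda>k. min (s k) (- t k)) \<longlonglongrightarrow> 0"
    for s t :: "nat \<Rightarrow> real"
    by (simp only: zero_ereal_def lim_ereal min_ereal_uminus)
  \<comment> \<open>The family is taken apart into its groups, and \<open>\<eta>\<close> is zero,
    the only normal vector of the whole space.\<close>
  show ?thesis
  proof (rule exI[of _ z], rule exI[of _ \<mu>], rule exI[of _ "\<lambda>k. \<alpha> k None"], rule exI[of _ "\<lambda>k i. \<alpha> k (Some (Inl i))"],
      rule exI[of _ "\<lambda>k j. \<alpha> k (Some (Inr j))"], rule exI[of _ \<xi>0], rule exI[of _ "\<lambda>k. \<xi> k None"],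
      rule exI[of _ "\<lambda>k i. \<xi> k (Some (Inl i))"], rule exI[of _ "\<lambda>k j. \<xi> k (Some (Inr j))"],
      rule exI[of _ "\<lambda>k. 0"], intro conjI)
    show "(\<lambda>k. norm (\<mu> k *\<^sub>R \<xi>0 k + \<alpha> k None *\<^sub>R \<xi> k None +
        (\<Sum>i=1..q. \<alpha> k (Some (Inl i)) *\<^sub>R \<xi> k (Some (Inl i))) +
        (\<Sum>j=1..p. \<alpha> k (Some (Inr j)) *\<^sub>R \<xi> k (Some (Inr j))) + 0)) \<longlonglongrightarrow> 0"
      using stat by (simp add: sum_I add.assoc)
    show "\<forall>k. (\<mu> k)\<^sup>2 + (\<alpha> k None)\<^sup>2 + (\<Sum>i=1..q. (\<alpha> k (Some (Inl i)))\<^sup>2) +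
        (\<Sum>j=1..p. (\<alpha> k (Some (Inr j)))\<^sup>2) = 1"
      using normed by (simp add: sum_I add.assoc)
  \<comment> \<open>Simplifying \<open>- ereal t\<close> to \<open>ereal (- t)\<close> would destroy
    the pattern that \<open>lim_min\<close> rewrites.\<close>
  qed (use z nonneg \<xi>0 \<xi>' compl' in
      \<open>simp_all add: I_iff h_simps limiting_normal_cone_UNIV lim_min del: uminus_ereal.simps\<close>)
qed

end
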